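(* Let $G$ and $H$ be graphs with $\mathrm{Fall}(G)\neq\emptyset$ and $\mathrm{Fall}(H)\neq\emptyset$. Then $$\left\{\sum_{i=1}^{s}k_i \;:\; s\in\mathrm{Fall}(G),\ k_i\in\mathrm{Fall}(H)\text{ for all }1\leq i\leq s\right\}\subseteq\mathrm{Fall}(G[H]).$$
   Context: All graphs are finite, simple (undirected, no loops, no multiple edges), with nonempty vertex set. For $k\in\mathbb{N}=\{1,2,\dots\}$ let $[k]=\{1,\dots,k\}$. A (proper) $k$-coloring of a graph $G$ is a function $f:V(G)\to[k]$ such that each $f^{-1}(i)$ is an independent set. It is a fall $k$-coloring if $f(N[v])=[k]$ for every $v\in V(G)$, where $N[v]$ is the closed neighborhood of $v$. $\mathrm{Fall}(G)$ is the set of all positive integers $k$ such that $G$ has a fall $k$-coloring. The lexicographic product $G[H]$ has vertex set $V(G)\times V(H)$, with $(x_1,y_1)$ adjacent to $(x_2,y_2)$ iff $\{x_1,x_2\}\in E(G)$, or $x_1=x_2$ and $\{y_1,y_2\}\in E(H)$. *)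

theory Defs
  imports "Graph_Theory.Graph_Theory"
begin

text \<open>
  An undirected edge \<open>{u, v}\<close> is represented by the two arcs \<open>(u, v)\<close> and \<open>(v, u)\<close>;
  \<open>pair_graph\<close> is then exactly the class of finite, loopless, symmetric graphs
  without parallel edges, but it allows the null graph.
\<close>

locale simple_graph = pair_graph +
  assumes verts_nonempty: "pverts G \<noteq> {}"

definition independent :: "'a pair_pre_digraph \<Rightarrow> 'a set \<Rightarrow> bool" where
  "independent G S \<longleftrightarrow> S \<subseteq> pverts G \<and> (\<forall>u\<in>S. \<forall>v\<in>S. (u, v) \<notin> parcs G)"

definition closed_neighborhood :: "'a pair_pre_digraph \<Rightarrow> 'a \<Rightarrow> 'a set" where
  "closed_neighborhood G v = insert v {u. (v, u) \<in> parcs G}"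

definition coloring :: "'a pair_pre_digraph \<Rightarrow> nat \<Rightarrow> ('a \<Rightarrow> nat) \<Rightarrow> bool" where
  "coloring G k f \<longleftrightarrow>
     f \<in> pverts G \<rightarrow> {1..k} \<and> (\<forall>i\<in>{1..k}. independent G {v \<in> pverts G. f v = i})"

definition fall_coloring :: "'a pair_pre_digraph \<Rightarrow> nat \<Rightarrow> ('a \<Rightarrow> nat) \<Rightarrow> bool" where
  "fall_coloring G k f \<longleftrightarrow>
     coloring G k f \<and> (\<forall>v\<in>pverts G. f ` closed_neighborhood G v = {1..k})"

definition Fall :: "'a pair_pre_digraph \<Rightarrow> nat set" where
  "Fall G = {k. k \<ge> 1 \<and> (\<exists>f. fall_coloring G k f)}"

definition lex_product ::
  "'a pair_pre_digraph \<Rightarrow> 'b pair_pre_digraph \<Rightarrow> ('a \<times> 'b) pair_pre_digraph" where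
  "lex_product G H =
     \<lparr> pverts = pverts G \<times> pverts H,
       parcs = {((x1, y1), (x2, y2)).
         (x1, y1) \<in> pverts G \<times> pverts H \<and> (x2, y2) \<in> pverts G \<times> pverts H \<and>
         ((x1, x2) \<in> parcs G \<or> x1 = x2 \<and> (y1, y2) \<in> parcs H)} \<rparr>"

lemma simple_graph_lex_product:
  assumes "simple_graph G" and "simple_graph H"
  shows "simple_graph (lex_product G H)"
proof -
  interpret G: simple_graph G by fact
  interpret H: simple_graph H by fact
  let ?V = "pverts G \<times> pverts H"
  have fin: "finite ?V"
    using G.pair_finite_verts H.pair_finite_verts by simp
  have sub: "parcs (lex_product G H) \<subseteq> ?V \<times> ?V"
    by (auto simp: lex_product_def)
  have symG: "(y, x) \<in> parcs G" if "(x, y) \<in> parcs G" for x y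
    using that G.pair_sym_arcs by (auto simp: symmetric_def dest: symD)
  have symH: "(y, x) \<in> parcs H" if "(x, y) \<in> parcs H" for x y
    using that H.pair_sym_arcs by (auto simp: symmetric_def dest: symD)
  show ?thesis
  proof
    show "finite (parcs (lex_product G H))"
      using finite_subset[OF sub] fin by blast
    show "finite (pverts (lex_product G H))"
      using fin by (simp add: lex_product_def)
    show "pverts (lex_product G H) \<noteq> {}"
      using G.verts_nonempty H.verts_nonempty by (simp add: lex_product_def)
    show "symmetric (with_proj (lex_product G H))"
      unfolding symmetric_def by (rule symI) (auto simp: lex_product_def intro: symG symH)
  next
    fix e assume e: "e \<in> parcs (lex_product G H)"
    show "fst e \<in> pverts (lex_product G H)" "snd e \<in> pverts (lex_product G H)"
      using e by (auto simp: lex_product_def)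
    show "fst e \<noteq> snd e"
      using e G.pair_no_loops H.pair_no_loops by (fastforce simp: lex_product_def)
  qed
qed

end

theory Submission
  imports Defs
begin

text \<open>
  Colour \<open>(x, y)\<close> lexicographically: the fall colouring of \<open>G\<close> at \<open>x\<close> selects one of \<open>s\<close>
  consecutive blocks of colours, the \<open>i\<close>-th of length \<open>k i\<close>, and a fall \<open>k i\<close>-colouring of \<open>H\<close>
  selects the colour inside the block. A vertex \<open>(x, y)\<close> sees its own block through \<open>{x} \<times> N[y]\<close>,
  and every other block through a full copy of \<open>H\<close> over a neighbour of \<open>x\<close>.
\<close>

lemma block_end_le:
  fixes k :: "nat \<Rightarrow> nat"
  assumes "1 \<le> i" and "i < j"
  shows "sum k {1..<i} + k i \<le> sum k {1..<j}"
proof -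
  have "sum k {1..<i} + k i = sum k {1..<Suc i}"
    using assms by simp
  also have "\<dots> \<le> sum k {1..<j}"
    using assms by (intro sum_mono2) auto
  finally show ?thesis .
qed

text \<open>Were \<open>i < j\<close>, then \<open>a \<le> k i\<close> would keep the left side at
  or below the offset of block \<open>j\<close>, while \<open>b \<ge> 1\<close> pushes the right
  side strictly above it; \<open>j < i\<close> is symmetric.\<close>

lemma block_index_unique:
  fixes k :: "nat \<Rightarrow> nat"
  assumes "sum k {1..<i} + a = sum k {1..<j} + b"
    and "1 \<le> i" and "1 \<le> j" and "a \<in> {1..k i}" and "b \<in> {1..k j}"
  shows "i = j"
  using block_end_le[of i j k] block_end_le[of j i k] assms
  by (cases i j rule: linorder_cases) auto

lemma Union_blocks:
  fixes k :: "nat \<Rightarrow> nat"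
  shows "(\<Union>i\<in>{1..s}. (+) (sum k {1..<i}) ` {1..k i}) = {1..sum k {1..s}}"
proof (induction s)
  case 0
  then show ?case by simp
next
  case (Suc s)
  \<comment> \<open>The offset of the new block is thus the total length of the first
    \<open>s\<close> blocks, so it starts right after the interval that they fill.\<close>
  have "{1..<Suc s} = {1..s}"
    by auto
  then have "(\<Union>i\<in>{1..Suc s}. (+) (sum k {1..<i}) ` {1..k i})
      = {1..sum k {1..s}} \<union> (+) (sum k {1..s}) ` {1..k (Suc s)}"
    by (simp only: Suc.IH[symmetric] atLeastAtMostSuc_conv[of 1 s]) auto
  also have "\<dots> = {1..sum k {1..s}} \<union> {sum k {1..s} + 1..sum k {1..s} + k (Suc s)}"
    by (simp only: image_add_atLeastAtMost add.commute)
  also have "\<dots> = {1..sum k {1..Suc s}}"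
    by auto
  finally show ?case .
qed

text \<open>Well-formedness puts both ends of an arc among the vertices, so an arc with equally
  coloured ends lies inside a colour class. Properness can then be checked arc by arc.\<close>

lemma coloring_iff:
  assumes "pair_wf_digraph G"
  shows "coloring G k f \<longleftrightarrow> f \<in> pverts G \<rightarrow> {1..k} \<and> (\<forall>(u, v)\<in>parcs G. f u \<noteq> f v)"
proof -
  have "u \<in> pverts G \<and> v \<in> pverts G" if "(u, v) \<in> parcs G" for u v
    using pair_wf_digraph.in_arcsD1[OF assms that] pair_wf_digraph.in_arcsD2[OF assms that] by simp
  then show ?thesis
    unfolding coloring_def independent_def by (auto simp: Pi_iff Ball_def) metis+
qed

lemma closed_neighborhood_lex_product:
  assumes "pair_wf_digraph G" and "pair_wf_digraph H"
    and "x \<in> pverts G" and "y \<in> pverts H"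
  shows "closed_neighborhood (lex_product G H) (x, y)
    = {x} \<times> closed_neighborhood H y \<union> {u. (x, u) \<in> parcs G} \<times> pverts H"
  using assms pair_wf_digraph.in_arcsD2[of G] pair_wf_digraph.in_arcsD2[of H]
  unfolding closed_neighborhood_def lex_product_def by auto

lemma fall_coloring_lex_product:
  fixes k :: "nat \<Rightarrow> nat"
  assumes "simple_graph G" and "simple_graph H"
    and f: "fall_coloring G s f"
    and h: "\<And>i. i \<in> {1..s} \<Longrightarrow> fall_coloring H (k i) (h i)"
  shows "fall_coloring (lex_product G H) (sum k {1..s})
    (\<lambda>(x, y). sum k {1..<f x} + h (f x) y)" (is "fall_coloring ?L ?n ?F")
proof -
  interpret G: simple_graph G by fact
  interpret H: simple_graph H by fact
  interpret L: simple_graph ?L by (rule simple_graph_lex_product) fact+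
  note G_wf = G.pair_wf_digraph_axioms and H_wf = H.pair_wf_digraph_axioms
  have f_range: "f x \<in> {1..s}" if "x \<in> pverts G" for x
    using f that by (auto simp: fall_coloring_def coloring_def)
  have f_proper: "f x \<noteq> f x'" if "(x, x') \<in> parcs G" for x x'
    using f that by (auto simp: fall_coloring_def coloring_iff[OF G_wf])
  have f_fall: "f ` closed_neighborhood G x = {1..s}" if "x \<in> pverts G" for x
    using f that by (simp add: fall_coloring_def)
  have h_range: "h i y \<in> {1..k i}" if "i \<in> {1..s}" "y \<in> pverts H" for i y
    using h[OF that(1)] that(2) by (auto simp: fall_coloring_def coloring_def)
  have h_proper: "h i y \<noteq> h i y'" if "i \<in> {1..s}" "(y, y') \<in> parcs H" for i y y'
    using h[OF that(1)] that(2) by (auto simp: fall_coloring_def coloring_iff[OF H_wf])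
  have h_fall: "h i ` closed_neighborhood H y = {1..k i}" if "i \<in> {1..s}" "y \<in> pverts H" for i y
    using h[OF that(1)] that(2) by (simp add: fall_coloring_def)
  \<comment> \<open>A single vertex suffices, since its closed neighbourhood already shows every
    colour; one exists because \<open>H\<close> is nonempty.\<close>
  have h_onto: "h i ` pverts H = {1..k i}" if "i \<in> {1..s}" for i
  proof -
    obtain y where y: "y \<in> pverts H"
      using H.verts_nonempty by blast
    then have "closed_neighborhood H y \<subseteq> pverts H"
      by (auto simp: closed_neighborhood_def dest: H.in_arcsD2)
    then have "{1..k i} \<subseteq> h i ` pverts H"
      using h_fall[OF that y] by blast
    then show ?thesis
      using h_range[OF that] by blast
  qed
  have proper: "?F p \<noteq> ?F q" if "(p, q) \<in> parcs ?L" for p q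
  proof -
    obtain x y x' y' where [simp]: "p = (x, y)" "q = (x', y')"
      by (metis surj_pair)
    have V: "x \<in> pverts G" "y \<in> pverts H" "x' \<in> pverts G" "y' \<in> pverts H"
      and E: "(x, x') \<in> parcs G \<or> x = x' \<and> (y, y') \<in> parcs H"
      using that by (auto simp: lex_product_def)
    show ?thesis
    proof
      assume eq: "?F p = ?F q"
      \<comment> \<open>Equal colours lie in one block, so \<open>f\<close> agrees at
        \<open>x\<close> and \<open>x'\<close>. This rules out an arc of \<open>G\<close> and leaves
        an arc of \<open>H\<close> within one fibre, where \<open>h (f x)\<close> is proper.\<close>
      then have same: "f x = f x'"
        using block_index_unique[of k "f x" "h (f x) y" "f x'" "h (f x') y'"]
          f_range[OF V(1)] f_range[OF V(3)] h_range V by simp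
      then have "x = x'" "(y, y') \<in> parcs H"
        using E f_proper by blast+
      then show False
        using eq h_proper[OF f_range[OF V(1)]] by simp
    qed
  qed
  have fall: "?F ` closed_neighborhood ?L (x, y) = {1..?n}"
    if x: "x \<in> pverts G" and y: "y \<in> pverts H" for x y
  proof -
    have "?F ` ({x} \<times> closed_neighborhood H y) = (+) (sum k {1..<f x}) ` {1..k (f x)}"
      unfolding h_fall[OF f_range[OF x] y, symmetric] by force
    moreover have "?F ` ({u. (x, u) \<in> parcs G} \<times> pverts H)
        = (\<Union>u\<in>{u. (x, u) \<in> parcs G}. (+) (sum k {1..<f u}) ` h (f u) ` pverts H)"
      by force
    moreover have "\<dots> = (\<Union>u\<in>{u. (x, u) \<in> parcs G}. (+) (sum k {1..<f u}) ` {1..k (f u)})"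
      using h_onto[OF f_range[OF G.in_arcsD2]] by (intro SUP_cong refl) (simp only: mem_Collect_eq)
    ultimately have "?F ` closed_neighborhood ?L (x, y)
        = (\<Union>u\<in>closed_neighborhood G x. (+) (sum k {1..<f u}) ` {1..k (f u)})"
      unfolding closed_neighborhood_lex_product[OF G_wf H_wf x y] image_Un
      by (simp add: closed_neighborhood_def[of G])
    \<comment> \<open>A block depends on \<open>u\<close> only through \<open>f u\<close>, so the
      union may run over the colours that \<open>f\<close> shows around \<open>x\<close>, and these
      are all of \<open>{1..s}\<close>.\<close>
    also have "\<dots> = (\<Union>i\<in>f ` closed_neighborhood G x. (+) (sum k {1..<i}) ` {1..k i})"
      by simp
    also have "\<dots> = {1..?n}"
      unfolding f_fall[OF x] by (rule Union_blocks)
    finally show ?thesis .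
  qed
  have V: "pverts ?L = pverts G \<times> pverts H"
    by (simp add: lex_product_def)
  have L_fall: "\<forall>p\<in>pverts ?L. ?F ` closed_neighborhood ?L p = {1..?n}"
    unfolding V by (intro ballI, elim SigmaE, simp only: fall)
  have "?F p \<in> {1..?n}" if "p \<in> pverts ?L" for p
  proof -
    have "p \<in> closed_neighborhood ?L p"
      by (simp add: closed_neighborhood_def)
    then have "?F p \<in> ?F ` closed_neighborhood ?L p"
      by (rule imageI)
    then show ?thesis
      unfolding bspec[OF L_fall that] .
  qed
  then have "coloring ?L ?n ?F"
    unfolding coloring_iff[OF L.pair_wf_digraph_axioms] using proper by blast
  with L_fall show ?thesis
    unfolding fall_coloring_def by (rule conjI[rotated])
qed

theorem theorem2:
  fixes G :: "'a pair_pre_digraph" and H :: "'b pair_pre_digraph"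
  assumes "simple_graph G" and "simple_graph H"
    and "Fall G \<noteq> {}" and "Fall H \<noteq> {}"
  shows "{\<Sum>i=1..s. k i | (s::nat) (k :: nat \<Rightarrow> nat). s \<in> Fall G \<and> (\<forall>i\<in>{1..s}. k i \<in> Fall H)}
         \<subseteq> Fall (lex_product G H)"
proof clarify
  fix s :: nat and k :: "nat \<Rightarrow> nat"
  assume s: "s \<in> Fall G" and k: "\<forall>i\<in>{1..s}. k i \<in> Fall H"
  obtain f where f: "fall_coloring G s f"
    using s by (auto simp: Fall_def)
  have "\<forall>i\<in>{1..s}. \<exists>h. fall_coloring H (k i) h"
    using k by (simp add: Fall_def)
  then obtain h where h: "\<And>i. i \<in> {1..s} \<Longrightarrow> fall_coloring H (k i) (h i)"
    by (metis (no_types))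
  \<comment> \<open>\<open>Fall\<close> contains only positive numbers. The sum is positive because
    its first summand exists and is at least 1.\<close>
  have "1 \<in> {1..s}"
    using s by (simp add: Fall_def)
  then have "1 \<le> k 1" "k 1 \<le> sum k {1..s}"
    using k by (auto simp: Fall_def intro: member_le_sum)
  then show "sum k {1..s} \<in> Fall (lex_product G H)"
    using fall_coloring_lex_product[OF assms(1,2) f, of k h] h unfolding Fall_def by force
qed

end
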